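(* Let $h,n$ be integers with $h\ge 2$, $n-h\ge 2$ (so $n\ge 4$), and let $K_{h,n-h}$ be the complete bipartite graph with parts of sizes $h$ and $n-h$. Then the Mycielskian graph $\mu(K_{h,n-h})$ satisfies $\gamma_p(\mu(K_{h,n-h}))=2$.
   Context: All graphs are finite, simple and undirected. $N[v]$ denotes the closed neighborhood of $v$ and $N[S]=\bigcup_{v\in S}N[v]$. For $U\subseteq V(G)$, the closure $cl(U)$ is the set obtained from $U$ by repeatedly applying, until no more changes are possible, the rule: if a vertex $u$ is in the current set and exactly one neighbor $w$ of $u$ is not in it, then add $w$. A set $S\subseteq V(G)$ is a power dominating set of $G$ if $cl(N[S])=V(G)$, and the power domination number $\gamma_p(G)$ is the minimum cardinality of a power dominating set. For a graph $G$ with vertex set $V=\{v_1,\dots,v_n\}$, the Mycielskian graph $\mu(G)$ has vertex set $V\cup\{u_1,\dots,u_n\}\cup\{w\}$ (all these vertices distinct) and edge set $E(G)\cup\{u_iv_j : v_iv_j\in E(G)\}\cup\{u_iw : 1\le i\le n\}$. *)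

theory Defs
  imports "Graph_Theory.Graph_Theory"
begin

text \<open>
  A finite simple undirected graph is a \<^locale>\<open>pair_graph\<close>: an undirected edge is the pair of
  opposite arcs.
\<close>

definition neighborhood :: "'a pair_pre_digraph \<Rightarrow> 'a \<Rightarrow> 'a set" where
  "neighborhood G v = {w. (v, w) \<in> parcs G}"

definition closed_neighborhood :: "'a pair_pre_digraph \<Rightarrow> 'a \<Rightarrow> 'a set" where
  "closed_neighborhood G v = insert v (neighborhood G v)"

inductive force_step :: "'a pair_pre_digraph \<Rightarrow> 'a set \<Rightarrow> 'a set \<Rightarrow> bool" for G where
  "u \<in> A \<Longrightarrow> neighborhood G u - A = {w} \<Longrightarrow> force_step G A (insert w A)"

definition closure_of_rule :: "'a pair_pre_digraph \<Rightarrow> 'a set \<Rightarrow> 'a set \<Rightarrow> bool" where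
  "closure_of_rule G U C \<longleftrightarrow> (force_step G)\<^sup>*\<^sup>* U C \<and> (\<nexists>D. force_step G C D)"

text \<open>The description below is proper for finite graphs: see \<open>ex1_closure_of_rule\<close>.\<close>

definition forcing_closure :: "'a pair_pre_digraph \<Rightarrow> 'a set \<Rightarrow> 'a set" where
  "forcing_closure G U = (THE C. closure_of_rule G U C)"

definition power_dominating_set :: "'a pair_pre_digraph \<Rightarrow> 'a set \<Rightarrow> bool" where
  "power_dominating_set G S \<longleftrightarrow>
     S \<subseteq> pverts G \<and> forcing_closure G (\<Union>v\<in>S. closed_neighborhood G v) = pverts G"

definition power_domination_number :: "'a pair_pre_digraph \<Rightarrow> nat" where
  "power_domination_number G = (LEAST k. \<exists>S. power_dominating_set G S \<and> card S = k)"

datatype 'a mycielski_vertex = Original 'a | Shadow 'a | Apex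

definition mycielskian :: "'a pair_pre_digraph \<Rightarrow> 'a mycielski_vertex pair_pre_digraph" where
  "mycielskian G =
     (let E = {(Original x, Original y) | x y. (x, y) \<in> parcs G}
            \<union> {(Shadow x, Original y) | x y. (x, y) \<in> parcs G}
            \<union> {(Shadow x, Apex) | x. x \<in> pverts G}
      in \<lparr> pverts = Original ` pverts G \<union> Shadow ` pverts G \<union> {Apex},
           parcs = E \<union> E\<inverse> \<rparr>)"

lemma force_steps_subset_stuck:
  assumes "(force_step G)\<^sup>*\<^sup>* U A" and "U \<subseteq> C" and "\<nexists>D. force_step G C D"
  shows "A \<subseteq> C"
  using assms(1)
proof (induction rule: rtranclp_induct)
  case base
  show ?case by (rule assms(2))
next
  case (step A B)
  from step.hyps(2) obtain u w where uw: "u \<in> A" "neighborhood G u - A = {w}" "B = insert w A"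
    by (auto elim: force_step.cases)
  have "w \<in> C"
  proof (rule ccontr)
    assume "w \<notin> C"
    then have "neighborhood G u - C = {w}" using uw(2) step.IH by blast
    then show False using force_step.intros[of u C G w] uw(1) step.IH assms(3) by blast
  qed
  then show ?case using uw step.IH by blast
qed

lemma force_steps_mono: "(force_step G)\<^sup>*\<^sup>* U A \<Longrightarrow> U \<subseteq> A"
  by (induction rule: rtranclp_induct) (auto elim!: force_step.cases)

lemma (in pair_fin_digraph) ex_closure_of_rule:
  assumes "U \<subseteq> pverts G"
  shows "\<exists>C. closure_of_rule G U C"
  using assms
proof (induction "card (pverts G - U)" arbitrary: U rule: less_induct)
  case less
  show ?case
  proof (cases "\<exists>D. force_step G U D")
    case False
    then show ?thesis unfolding closure_of_rule_def by blast
  next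
    case True
    then obtain D where D: "force_step G U D" by blast
    then obtain u w where uw: "neighborhood G u - U = {w}" "D = insert w U"
      by (auto elim: force_step.cases)
    from uw(1) have w: "w \<in> pverts G" "w \<notin> U"
      using in_arcsD2 unfolding neighborhood_def by blast+
    then have "card (pverts G - D) < card (pverts G - U)"
      using pair_finite_verts uw(2) by (intro psubset_card_mono) auto
    moreover have "D \<subseteq> pverts G" using w less.prems uw(2) by blast
    ultimately obtain C where "closure_of_rule G D C" using less.hyps by blast
    with D have "closure_of_rule G U C"
      unfolding closure_of_rule_def by (meson converse_rtranclp_into_rtranclp)
    then show ?thesis ..
  qed
qed

lemma closure_of_rule_unique:
  assumes "closure_of_rule G U C" and "closure_of_rule G U D"
  shows "C = D"
proof -
  have C: "(force_step G)\<^sup>*\<^sup>* U C" "\<nexists>E. force_step G C E"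
    and D: "(force_step G)\<^sup>*\<^sup>* U D" "\<nexists>E. force_step G D E"
    using assms unfolding closure_of_rule_def by blast+
  show ?thesis
  proof (rule subset_antisym)
    show "C \<subseteq> D"
      by (rule force_steps_subset_stuck[OF C(1) force_steps_mono[OF D(1)] D(2)])
    show "D \<subseteq> C"
      by (rule force_steps_subset_stuck[OF D(1) force_steps_mono[OF C(1)] C(2)])
  qed
qed

lemma (in pair_fin_digraph) ex1_closure_of_rule:
  assumes "U \<subseteq> pverts G"
  shows "\<exists>!C. closure_of_rule G U C"
  using ex_closure_of_rule[OF assms] closure_of_rule_unique by blast

lemma forcing_closure_eqI: "closure_of_rule G U C \<Longrightarrow> forcing_closure G U = C"
  unfolding forcing_closure_def by (rule the_equality, assumption, rule closure_of_rule_unique)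

lemma (in pair_graph) pair_graph_mycielskian: "pair_graph (mycielskian G)"
proof -
  have fin: "finite (pverts (mycielskian G))"
    using pair_finite_verts by (auto simp: mycielskian_def Let_def)
  have sub: "parcs (mycielskian G) \<subseteq> pverts (mycielskian G) \<times> pverts (mycielskian G)"
    by (auto simp: mycielskian_def Let_def dest: in_arcsD1 in_arcsD2)
  have "finite (parcs (mycielskian G))"
    using fin sub by (meson finite_SigmaI finite_subset)
  moreover have "sym (parcs (mycielskian G))"
    unfolding mycielskian_def Let_def by (simp add: sym_Un_converse)
  moreover have "fst e \<noteq> snd e" if "e \<in> parcs (mycielskian G)" for e
    using that by (auto simp: mycielskian_def Let_def dest: no_loops')
  ultimately show ?thesis
    using fin sub by unfold_locales (auto simp: symmetric_def)
qed

end

theory Submission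
  imports Defs
begin

text \<open>
  Both bounds come from facts about the Mycielskian of an arbitrary graph \<open>G\<close>.

  For the upper bound, choose a set \<open>T\<close> of vertices such that every vertex of \<open>G\<close> has a neighbour
  in \<open>T\<close> (a total dominating set). The original copies of \<open>T\<close> then dominate every original vertex
  and every shadow, so that only the apex is left, and any shadow forces it
  (\<open>power_dominating_total\<close>). In a complete bipartite graph the two ends of an edge form such a set.

  For the lower bound, call two distinct vertices with the same neighbourhood twins. A vertex
  adjacent to one of them is adjacent to the other, so that it never has exactly one uncoloured
  neighbour as long as both are uncoloured. Hence the closure of a set that misses a pair of twins
  misses it too (\<open>twins_not_forced\<close>), and a power dominating set must touch every pair of twins with
  its closed neighbourhood. A pair of twins of \<open>G\<close> gives two pairs in the Mycielskian, the
  originals and the shadows, and a single vertex \<open>x\<close> cannot reach all pairs. If \<open>x\<close> is the original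
  of \<open>a\<close>, it misses the shadows of any twins not adjacent to \<open>a\<close>; if \<open>x\<close> is the shadow of \<open>a\<close>, it
  misses their originals; the apex misses all originals (\<open>power_dominating_card_ge_2\<close>). In a
  complete bipartite graph whose sides have at least two elements, two vertices on the side of \<open>a\<close>
  are twins not adjacent to \<open>a\<close>.
\<close>

lemma (in pair_graph) neighborhood_sym: "x \<in> neighborhood G y \<longleftrightarrow> y \<in> neighborhood G x"
  using arcs_symmetric unfolding neighborhood_def by blast

lemma (in pair_graph) neighborhood_subset: "neighborhood G v \<subseteq> pverts G"
  using in_arcsD2 unfolding neighborhood_def by blast

lemma (in pair_graph) closed_neighborhoods_subset:
  "S \<subseteq> pverts G \<Longrightarrow> (\<Union>v\<in>S. closed_neighborhood G v) \<subseteq> pverts G"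
  using neighborhood_subset unfolding closed_neighborhood_def by blast

lemma (in pair_graph) forcing_closure_steps:
  assumes "U \<subseteq> pverts G"
  shows "(force_step G)\<^sup>*\<^sup>* U (forcing_closure G U)"
  using ex_closure_of_rule[OF assms] forcing_closure_eqI
  unfolding closure_of_rule_def by metis

lemma (in pair_graph) forcing_closure_eq_pverts:
  assumes "(force_step G)\<^sup>*\<^sup>* U (pverts G)"
  shows "forcing_closure G U = pverts G"
proof -
  have "\<nexists>D. force_step G (pverts G) D"
    using neighborhood_subset by (blast elim: force_step.cases)
  with assms show ?thesis
    by (intro forcing_closure_eqI) (simp add: closure_of_rule_def)
qed

text \<open>
  A vertex that could force one of the twins has the other as a second uncoloured neighbour.
\<close>

lemma (in pair_graph) twins_not_forced:
  assumes twins: "p \<noteq> q" "neighborhood G p = neighborhood G q"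
    and "(force_step G)\<^sup>*\<^sup>* U A" and "p \<notin> U" "q \<notin> U"
  shows "p \<notin> A \<and> q \<notin> A"
  using assms(3)
proof (induction rule: rtranclp_induct)
  case base
  show ?case using assms(4,5) by blast
next
  case (step A B)
  from step.hyps(2) obtain u w where uw: "neighborhood G u - A = {w}" "B = insert w A"
    by (auto elim: force_step.cases)
  have "p \<in> neighborhood G u \<longleftrightarrow> q \<in> neighborhood G u"
    using twins(2) neighborhood_sym by blast
  with uw(1) step.IH twins(1) have "w \<noteq> p \<and> w \<noteq> q" by (metis Diff_iff singletonD singletonI)
  with step.IH uw(2) show ?case by blast
qed

corollary (in pair_graph) power_dominating_set_touches_twins:
  assumes "power_dominating_set G S"
    and "p \<noteq> q" "neighborhood G p = neighborhood G q" "p \<in> pverts G"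
  shows "\<exists>v\<in>S. p \<in> closed_neighborhood G v \<or> q \<in> closed_neighborhood G v"
  using assms twins_not_forced[OF assms(2,3) forcing_closure_steps[OF closed_neighborhoods_subset]]
  unfolding power_dominating_set_def by blast

lemma pverts_mycielskian:
  "pverts (mycielskian G) = Original ` pverts G \<union> Shadow ` pverts G \<union> {Apex}"
  by (simp add: mycielskian_def Let_def)

lemma neighborhood_Apex: "neighborhood (mycielskian G) Apex = Shadow ` pverts G"
  by (auto simp: mycielskian_def Let_def neighborhood_def)

lemma neighborhood_Shadow:
  assumes "x \<in> pverts G"
  shows "neighborhood (mycielskian G) (Shadow x) = insert Apex (Original ` neighborhood G x)"
  using assms by (auto simp: mycielskian_def Let_def neighborhood_def)

lemma (in pair_graph) neighborhood_Original:
  "neighborhood (mycielskian G) (Original x) =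
     Original ` neighborhood G x \<union> Shadow ` neighborhood G x"
  using arcs_symmetric by (auto simp: mycielskian_def Let_def neighborhood_def)

text \<open>
  The vertex \<open>a\<close> may itself be one of the twins, as it is for \<open>p = a\<close> in a complete bipartite graph.
  Its original would then reach the pair of originals, which is why each layer is tested against
  the twins in the other one.
\<close>

lemma (in pair_graph) power_dominating_card_ge_2:
  assumes nonempty: "pverts G \<noteq> {}"
    and twins: "\<And>a. a \<in> pverts G \<Longrightarrow>
      \<exists>p q. p \<in> pverts G \<and> q \<in> pverts G \<and> p \<noteq> q \<and> neighborhood G p = neighborhood G q
        \<and> p \<notin> neighborhood G a \<and> q \<notin> neighborhood G a"
    and S: "power_dominating_set (mycielskian G) S"
  shows "card S \<ge> 2"
proof (rule ccontr)
  interpret M: pair_graph "mycielskian G" by (rule pair_graph_mycielskian)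
  assume "\<not> card S \<ge> 2"
  moreover have S_sub: "S \<subseteq> pverts (mycielskian G)"
    using S by (simp add: power_dominating_set_def)
  moreover have "finite S" using S_sub M.pair_finite_verts by (rule finite_subset)
  ultimately have "S = {} \<or> (\<exists>x. S = {x})"
    by (metis One_nat_def card_0_eq card_1_singletonE less_2_cases not_le)
  \<comment> \<open>The empty set is treated together with the apex.\<close>
  with S_sub obtain x where x: "x \<in> pverts (mycielskian G)" "S \<subseteq> {x}"
    by (auto simp: pverts_mycielskian)
  have reach: "p \<in> closed_neighborhood (mycielskian G) x \<or> q \<in> closed_neighborhood (mycielskian G) x"
    if "p \<noteq> q" "neighborhood (mycielskian G) p = neighborhood (mycielskian G) q"
      "p \<in> pverts (mycielskian G)" for p q
    using M.power_dominating_set_touches_twins[OF S that] x(2) by blast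
  have originals: "Original p \<in> closed_neighborhood (mycielskian G) x
      \<or> Original q \<in> closed_neighborhood (mycielskian G) x"
    if "p \<in> pverts G" "p \<noteq> q" "neighborhood G p = neighborhood G q" for p q
    using reach[of "Original p" "Original q"] that
    by (simp add: neighborhood_Original pverts_mycielskian)
  have shadows: "Shadow p \<in> closed_neighborhood (mycielskian G) x
      \<or> Shadow q \<in> closed_neighborhood (mycielskian G) x"
    if "p \<in> pverts G" "q \<in> pverts G" "p \<noteq> q" "neighborhood G p = neighborhood G q" for p q
    using reach[of "Shadow p" "Shadow q"] that
    by (simp add: neighborhood_Shadow pverts_mycielskian)
  show False
  proof (cases x)
    case (Original a)
    then have "a \<in> pverts G" using x(1) by (auto simp: pverts_mycielskian)
    then obtain p q where "p \<in> pverts G" "q \<in> pverts G" "p \<noteq> q"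
      "neighborhood G p = neighborhood G q" "p \<notin> neighborhood G a" "q \<notin> neighborhood G a"
      using twins by blast
    then show False using shadows[of p q] Original
      by (auto simp: closed_neighborhood_def neighborhood_Original)
  next
    case (Shadow a)
    then have a: "a \<in> pverts G" using x(1) by (auto simp: pverts_mycielskian)
    then obtain p q where "p \<in> pverts G" "p \<noteq> q"
      "neighborhood G p = neighborhood G q" "p \<notin> neighborhood G a" "q \<notin> neighborhood G a"
      using twins by blast
    then show False using originals[of p q] Shadow a
      by (auto simp: closed_neighborhood_def neighborhood_Shadow)
  next
    case Apex
    obtain p q where "p \<in> pverts G" "p \<noteq> q" "neighborhood G p = neighborhood G q"
      using twins nonempty by blast
    then show False using originals[of p q] Apex
      by (auto simp: closed_neighborhood_def neighborhood_Apex)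
  qed
qed

text \<open>
  An original vertex is adjacent to both copies of each of its neighbours, so that total domination
  in \<open>G\<close> covers both layers at once. Plain domination may leave the shadow of an element of \<open>T\<close>
  uncovered.
\<close>

lemma (in pair_graph) power_dominating_total:
  assumes nonempty: "pverts G \<noteq> {}"
    and T: "T \<subseteq> pverts G" "(\<Union>v\<in>T. neighborhood G v) = pverts G"
  shows "power_dominating_set (mycielskian G) (Original ` T)"
proof -
  interpret M: pair_graph "mycielskian G" by (rule pair_graph_mycielskian)
  let ?N = "\<Union>v\<in>Original ` T. closed_neighborhood (mycielskian G) v"
  have N: "?N = Original ` pverts G \<union> Shadow ` pverts G"
  proof -
    have "?N = Original ` T \<union> Original ` (\<Union>v\<in>T. neighborhood G v)
        \<union> Shadow ` (\<Union>v\<in>T. neighborhood G v)"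
      by (simp add: closed_neighborhood_def neighborhood_Original) blast
    then show ?thesis unfolding T(2) using T(1) by blast
  qed
  obtain a where a: "a \<in> pverts G" using nonempty by blast
  have "neighborhood (mycielskian G) (Shadow a) - ?N = {Apex}"
    unfolding N neighborhood_Shadow[OF a] using neighborhood_subset by auto
  then have "force_step (mycielskian G) ?N (insert Apex ?N)"
    using a N by (intro force_step.intros[of "Shadow a"]) auto
  moreover have "insert Apex ?N = pverts (mycielskian G)"
    unfolding N pverts_mycielskian by simp
  ultimately have "forcing_closure (mycielskian G) ?N = pverts (mycielskian G)"
    by (intro M.forcing_closure_eq_pverts) auto
  then show ?thesis
    using T(1) by (auto simp: power_dominating_set_def pverts_mycielskian)
qed

theorem theorem25:
  fixes h n :: nat and G :: "'a pair_pre_digraph"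
  assumes "h \<ge> 2" and "n - h \<ge> 2"
    and "complete_bipartite_digraph h (n - h) (with_proj G)"
  shows "power_domination_number (mycielskian G) = 2"
proof -
  interpret pair_graph G using assms(3) by (rule pair_graphI_complete_bipartite)
  obtain U V where UV: "pverts G = U \<union> V" "U \<inter> V = {}" "card U = h" "card V = n - h"
      "parcs G = U \<times> V \<union> V \<times> U"
    using assms(3) unfolding complete_bipartite_digraph_pair_def by blast
  have nbU: "neighborhood G x = V" if "x \<in> U" for x
    using that UV by (auto simp: neighborhood_def)
  have nbV: "neighborhood G x = U" if "x \<in> V" for x
    using that UV by (auto simp: neighborhood_def)
  obtain u u' where u: "u \<in> U" "u' \<in> U" "u \<noteq> u'"
    using assms(1) UV(3) by (metis card_le_Suc0_iff_eq card.infinite not_less_eq_eq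
      numeral_2_eq_2 not_numeral_le_zero)
  obtain v v' where v: "v \<in> V" "v' \<in> V" "v \<noteq> v'"
    using assms(2) UV(4) by (metis card_le_Suc0_iff_eq card.infinite not_less_eq_eq
      numeral_2_eq_2 not_numeral_le_zero)
  have nonempty: "pverts G \<noteq> {}" using u(1) UV(1) by blast
  have twins: "\<exists>p q. p \<in> pverts G \<and> q \<in> pverts G \<and> p \<noteq> q \<and> neighborhood G p = neighborhood G q
        \<and> p \<notin> neighborhood G a \<and> q \<notin> neighborhood G a" if "a \<in> pverts G" for a
  proof (cases "a \<in> U")
    case True
    have "u \<notin> V" "u' \<notin> V" using u UV(2) by auto
    with True show ?thesis using u UV(1) nbU by (intro exI[of _ u] exI[of _ u']) auto
  next
    case False
    with that have "a \<in> V" using UV(1) by blast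
    moreover have "v \<notin> U" "v' \<notin> U" using v UV(2) by auto
    ultimately show ?thesis using v UV(1) nbV by (intro exI[of _ v] exI[of _ v']) auto
  qed
  have "power_dominating_set (mycielskian G) (Original ` {u, v})"
    using u v UV(1) nbU nbV by (intro power_dominating_total nonempty) auto
  moreover have "card (Original ` {u, v}) = 2"
  proof -
    have "u \<noteq> v" using u(1) v(1) UV(2) by blast
    then show ?thesis by simp
  qed
  ultimately show ?thesis
    unfolding power_domination_number_def
    using power_dominating_card_ge_2[OF nonempty twins]
    by (intro Least_equality) blast+
qed

end
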